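(* Let $\mathcal{L}$ be a finite relational classical first-order signature and let $\mathcal{M}$ be a countable absolutely ubiquitous $\mathcal{L}$-structure. Let $X_1,\ldots,X_n$ be a finite partition of $M$ witnessing that $\mathcal{M}$ is finitely partitioned, and let $\mathcal{M}'=(\mathcal{M};X_1,\ldots,X_n)$ be the expansion of $\mathcal{M}$ to the signature $\mathcal{L}'=\mathcal{L}\cup\{R_1,\ldots,R_n\}$, where $R_i$ is a new unary relation symbol interpreted as $X_i$. Then given any function $f:M^r\to M$ definable in $\mathcal{M}'$, there are elements $b_1,\ldots,b_m\in M$ such that, for all $\vec a=(a_1,\ldots,a_r)\in M^r$, we have either $f(\vec a)=a_i$ for some $i\in\{1,\ldots,r\}$ or $f(\vec a)=b_j$ for some $j\in\{1,\ldots,m\}$.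
   Context: Classical first-order logic; definable means definable with parameters. $\mathcal{M}$ is locally finite if every finitely generated substructure is finite, and uniformly locally finite if there is $g:\mathbb{N}^{>0}\to\mathbb{N}^{>0}$ such that every $A\subseteq M$ with $|A|\le n$ generates a substructure of size at most $g(n)$. $\mathrm{Age}(\mathcal{M})$ is the set of isomorphism classes of finitely generated substructures of $\mathcal{M}$. A countable structure $\mathcal{M}$ in a finite signature is absolutely ubiquitous if it is uniformly locally finite and every countable, locally finite structure $\mathcal{N}$ in the same signature with $\mathrm{Age}(\mathcal{N})=\mathrm{Age}(\mathcal{M})$ is isomorphic to $\mathcal{M}$. $\mathcal{M}$ is finitely partitioned if there is a finite partition $X_1,\ldots,X_n$ of $M$ such that $\mathrm{Sym}(X_1)\times\cdots\times\mathrm{Sym}(X_n)$ is a subgroup of $\mathrm{Aut}(\mathcal{M})$; such a partition is said to witness this. (A theorem of Hodkinson and Macpherson: for finite relational signatures, $\mathcal{M}$ is absolutely ubiquitous if and only if it is finitely partitioned.) *)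

theory Defs
  imports "HOL-Algebra.Group" "HOL-Combinatorics.Permutations"
    "HOL-Library.Countable_Set" "HOL-Library.Disjoint_Sets"
begin

text \<open>Signatures are arbitrary first-order signatures; constant symbols are function symbols of
  arity 0. The arity functions matter only on the symbols of the signature.\<close>

record ('f, 'r) signature =
  funs :: "'f set"
  rels :: "'r set"
  fun_arity :: "'f \<Rightarrow> nat"
  rel_arity :: "'r \<Rightarrow> nat"

definition finite_signature :: "('f, 'r) signature \<Rightarrow> bool" where
  "finite_signature L \<longleftrightarrow> finite (funs L) \<and> finite (rels L)"

definition relational_signature :: "('f, 'r) signature \<Rightarrow> bool" where
  "relational_signature L \<longleftrightarrow> funs L = {}"

record ('a, 'f, 'r) structr =
  univ :: "'a set"
  fun_int :: "'f \<Rightarrow> 'a list \<Rightarrow> 'a"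
  rel_int :: "'r \<Rightarrow> 'a list set"

definition tuples :: "'a set \<Rightarrow> nat \<Rightarrow> 'a list set" where
  "tuples A k = {xs. length xs = k \<and> set xs \<subseteq> A}"

text \<open>The universe is allowed to be empty, so that the empty set generates a substructure also
  when there are no constant symbols. As all structures for a relational signature then have the
  empty structure in their age, this does not affect whether two ages are equal.\<close>

definition is_structure :: "('f, 'r) signature \<Rightarrow> ('a, 'f, 'r) structr \<Rightarrow> bool" where
  "is_structure L M \<longleftrightarrow>
     (\<forall>F\<in>funs L. \<forall>xs\<in>tuples (univ M) (fun_arity L F). fun_int M F xs \<in> univ M) \<and>
     (\<forall>R\<in>rels L. rel_int M R \<subseteq> tuples (univ M) (rel_arity L R))"

definition is_isomorphism ::
  "('f, 'r) signature \<Rightarrow> ('a, 'f, 'r) structr \<Rightarrow> ('b, 'f, 'r) structr \<Rightarrow> ('a \<Rightarrow> 'b) \<Rightarrow> bool" where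
  "is_isomorphism L M N h \<longleftrightarrow>
     bij_betw h (univ M) (univ N) \<and>
     (\<forall>F\<in>funs L. \<forall>xs\<in>tuples (univ M) (fun_arity L F).
        h (fun_int M F xs) = fun_int N F (map h xs)) \<and>
     (\<forall>R\<in>rels L. \<forall>xs\<in>tuples (univ M) (rel_arity L R).
        xs \<in> rel_int M R \<longleftrightarrow> map h xs \<in> rel_int N R)"

definition isomorphic ::
  "('f, 'r) signature \<Rightarrow> ('a, 'f, 'r) structr \<Rightarrow> ('b, 'f, 'r) structr \<Rightarrow> bool" where
  "isomorphic L M N \<longleftrightarrow> (\<exists>h. is_isomorphism L M N h)"

definition generated_universe ::
  "('f, 'r) signature \<Rightarrow> ('a, 'f, 'r) structr \<Rightarrow> 'a set \<Rightarrow> 'a set" where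
  "generated_universe L M A =
     \<Inter>{B. A \<subseteq> B \<and> B \<subseteq> univ M \<and>
         (\<forall>F\<in>funs L. \<forall>xs\<in>tuples B (fun_arity L F). fun_int M F xs \<in> B)}"

definition generated_substructure ::
  "('f, 'r) signature \<Rightarrow> ('a, 'f, 'r) structr \<Rightarrow> 'a set \<Rightarrow> ('a, 'f, 'r) structr" where
  "generated_substructure L M A =
     \<lparr>univ = generated_universe L M A,
      fun_int = fun_int M,
      rel_int = (\<lambda>R. rel_int M R \<inter> tuples (generated_universe L M A) (rel_arity L R))\<rparr>"

definition locally_finite :: "('f, 'r) signature \<Rightarrow> ('a, 'f, 'r) structr \<Rightarrow> bool" where
  "locally_finite L M \<longleftrightarrow>
     (\<forall>A. finite A \<and> A \<subseteq> univ M \<longrightarrow> finite (univ (generated_substructure L M A)))"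

definition uniformly_locally_finite :: "('f, 'r) signature \<Rightarrow> ('a, 'f, 'r) structr \<Rightarrow> bool" where
  "uniformly_locally_finite L M \<longleftrightarrow>
     (\<exists>g :: nat \<Rightarrow> nat. \<forall>k>0. g k > 0 \<and>
        (\<forall>A. finite A \<and> A \<subseteq> univ M \<and> card A \<le> k \<longrightarrow>
             finite (univ (generated_substructure L M A)) \<and>
             card (univ (generated_substructure L M A)) \<le> g k))"

text \<open>Finitely generated structures in a countable signature are countable, so their isomorphism
  types are determined by their isomorphic copies on subsets of \<open>nat\<close>. Taking isomorphism classes
  among the latter allows ages of structures over different types to be compared.\<close>

definition iso_class ::
  "('f, 'r) signature \<Rightarrow> ('a, 'f, 'r) structr \<Rightarrow> (nat, 'f, 'r) structr set" where
  "iso_class L M = {B. is_structure L B \<and> isomorphic L M B}"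

definition age ::
  "('f, 'r) signature \<Rightarrow> ('a, 'f, 'r) structr \<Rightarrow> (nat, 'f, 'r) structr set set" where
  "age L M = {iso_class L (generated_substructure L M A) | A. finite A \<and> A \<subseteq> univ M}"

text \<open>Every countable structure is isomorphic to one whose universe is a subset of \<open>nat\<close>, so it
  suffices to let \<open>N\<close> range over structures of the latter kind; these are automatically
  countable.\<close>

definition absolutely_ubiquitous :: "('f, 'r) signature \<Rightarrow> ('a, 'f, 'r) structr \<Rightarrow> bool" where
  "absolutely_ubiquitous L M \<longleftrightarrow>
     finite_signature L \<and> is_structure L M \<and> countable (univ M) \<and>
     uniformly_locally_finite L M \<and>
     (\<forall>N :: (nat, 'f, 'r) structr.
        is_structure L N \<and> locally_finite L N \<and> age L N = age L M \<longrightarrow> isomorphic L N M)"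

text \<open>Permutations of a set are total functions fixing every point outside of it.\<close>

definition Aut :: "('f, 'r) signature \<Rightarrow> ('a, 'f, 'r) structr \<Rightarrow> ('a \<Rightarrow> 'a) monoid" where
  "Aut L M =
     \<lparr>carrier = {p. p permutes univ M \<and> is_isomorphism L M M p}, monoid.mult = (\<circ>), one = id\<rparr>"

text \<open>The product of the groups of all permutations of \<open>X i\<close>, acting on the disjoint union of the
  sets \<open>X i\<close>: the family \<open>\<sigma>\<close> acts on \<open>X i\<close> as \<open>\<sigma> i\<close>.\<close>

definition Sym_product :: "nat \<Rightarrow> (nat \<Rightarrow> 'a set) \<Rightarrow> ('a \<Rightarrow> 'a) set" where
  "Sym_product n X =
     {p. \<exists>\<sigma>. (\<forall>i\<in>{1..n}. \<sigma> i permutes X i \<and> (\<forall>x\<in>X i. p x = \<sigma> i x)) \<and>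
             (\<forall>x. x \<notin> (\<Union>i\<in>{1..n}. X i) \<longrightarrow> p x = x)}"

definition witnesses_finitely_partitioned ::
  "('f, 'r) signature \<Rightarrow> ('a, 'f, 'r) structr \<Rightarrow> nat \<Rightarrow> (nat \<Rightarrow> 'a set) \<Rightarrow> bool" where
  "witnesses_finitely_partitioned L M n X \<longleftrightarrow>
     inj_on X {1..n} \<and> partition_on (univ M) (X ` {1..n}) \<and>
     subgroup (Sym_product n X) (Aut L M)"

definition expand_signature :: "('f, 'r) signature \<Rightarrow> nat \<Rightarrow> ('f, 'r + nat) signature" where
  "expand_signature L n =
     \<lparr>funs = funs L,
      rels = Inl ` rels L \<union> Inr ` {1..n},
      fun_arity = fun_arity L,
      rel_arity = case_sum (rel_arity L) (\<lambda>_. 1)\<rparr>"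

definition expand_structure ::
  "('a, 'f, 'r) structr \<Rightarrow> (nat \<Rightarrow> 'a set) \<Rightarrow> ('a, 'f, 'r + nat) structr" where
  "expand_structure M X =
     \<lparr>univ = univ M,
      fun_int = fun_int M,
      rel_int = case_sum (rel_int M) (\<lambda>i. {[x] | x. x \<in> X i})\<rparr>"

datatype 'f trm = Var nat | Fn 'f "'f trm list"

datatype ('f, 'r) fm =
    Eq "'f trm" "'f trm"
  | Rel 'r "'f trm list"
  | Neg "('f, 'r) fm"
  | And "('f, 'r) fm" "('f, 'r) fm"
  | Ex nat "('f, 'r) fm"

primrec trm_vars :: "'f trm \<Rightarrow> nat set" where
  "trm_vars (Var i) = {i}"
| "trm_vars (Fn F ts) = \<Union>(set (map trm_vars ts))"

primrec free_vars :: "('f, 'r) fm \<Rightarrow> nat set" where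
  "free_vars (Eq s t) = trm_vars s \<union> trm_vars t"
| "free_vars (Rel R ts) = (\<Union>t\<in>set ts. trm_vars t)"
| "free_vars (Neg \<phi>) = free_vars \<phi>"
| "free_vars (And \<phi> \<psi>) = free_vars \<phi> \<union> free_vars \<psi>"
| "free_vars (Ex i \<phi>) = free_vars \<phi> - {i}"

primrec wf_trm :: "('f, 'r) signature \<Rightarrow> 'f trm \<Rightarrow> bool" where
  "wf_trm L (Var i) \<longleftrightarrow> True"
| "wf_trm L (Fn F ts) \<longleftrightarrow>
     F \<in> funs L \<and> length ts = fun_arity L F \<and> list_all id (map (wf_trm L) ts)"

primrec wf_fm :: "('f, 'r) signature \<Rightarrow> ('f, 'r) fm \<Rightarrow> bool" where
  "wf_fm L (Eq s t) \<longleftrightarrow> wf_trm L s \<and> wf_trm L t"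
| "wf_fm L (Rel R ts) \<longleftrightarrow>
     R \<in> rels L \<and> length ts = rel_arity L R \<and> (\<forall>t\<in>set ts. wf_trm L t)"
| "wf_fm L (Neg \<phi>) \<longleftrightarrow> wf_fm L \<phi>"
| "wf_fm L (And \<phi> \<psi>) \<longleftrightarrow> wf_fm L \<phi> \<and> wf_fm L \<psi>"
| "wf_fm L (Ex i \<phi>) \<longleftrightarrow> wf_fm L \<phi>"

primrec trm_val :: "('a, 'f, 'r) structr \<Rightarrow> (nat \<Rightarrow> 'a) \<Rightarrow> 'f trm \<Rightarrow> 'a" where
  "trm_val M e (Var i) = e i"
| "trm_val M e (Fn F ts) = fun_int M F (map (trm_val M e) ts)"

primrec sat :: "('a, 'f, 'r) structr \<Rightarrow> (nat \<Rightarrow> 'a) \<Rightarrow> ('f, 'r) fm \<Rightarrow> bool" where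
  "sat M e (Eq s t) \<longleftrightarrow> trm_val M e s = trm_val M e t"
| "sat M e (Rel R ts) \<longleftrightarrow> map (trm_val M e) ts \<in> rel_int M R"
| "sat M e (Neg \<phi>) \<longleftrightarrow> \<not> sat M e \<phi>"
| "sat M e (And \<phi> \<psi>) \<longleftrightarrow> sat M e \<phi> \<and> sat M e \<psi>"
| "sat M e (Ex i \<phi>) \<longleftrightarrow> (\<exists>x\<in>univ M. sat M (e(i := x)) \<phi>)"

text \<open>Definability is with parameters: the variables \<open>0, \<dots>, k - 1\<close> stand for the components of
  a tuple, the next \<open>length cs\<close> variables for the parameters \<open>cs\<close>.\<close>

definition definable_set ::
  "('f, 'r) signature \<Rightarrow> ('a, 'f, 'r) structr \<Rightarrow> nat \<Rightarrow> 'a list set \<Rightarrow> bool" where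
  "definable_set L M k S \<longleftrightarrow>
     (\<exists>\<phi> cs. wf_fm L \<phi> \<and> set cs \<subseteq> univ M \<and> free_vars \<phi> \<subseteq> {..<k + length cs} \<and>
        S = {as \<in> tuples (univ M) k. sat M (\<lambda>i. (as @ cs) ! i) \<phi>})"

definition definable_function ::
  "('f, 'r) signature \<Rightarrow> ('a, 'f, 'r) structr \<Rightarrow> nat \<Rightarrow> ('a list \<Rightarrow> 'a) \<Rightarrow> bool" where
  "definable_function L M r f \<longleftrightarrow>
     (\<forall>as\<in>tuples (univ M) r. f as \<in> univ M) \<and>
     definable_set L M (Suc r) {as @ [f as] | as. as \<in> tuples (univ M) r}"

end

theory Submission
  imports Defs
begin

text \<open>A function definable with parameters \<open>cs\<close> commutes with every automorphism of the
  expansion that fixes \<open>cs\<close>. Suppose that the value \<open>f as\<close> lies in the part \<open>X i\<close>, is not an entry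
  of \<open>as\<close> or \<open>cs\<close>, and that \<open>X i\<close> is infinite. Then \<open>X i\<close> has a further element \<open>y\<close> distinct from
  \<open>f as\<close> and from all entries of \<open>as\<close> and \<open>cs\<close>. The transposition of \<open>f as\<close> and \<open>y\<close> belongs to the
  product of the symmetric groups of the parts (\<open>transpose_in_Sym_product\<close>), so it is an
  automorphism of \<open>M\<close>, and it stabilises each part, so it is an automorphism of the expansion
  (\<open>is_isomorphism_expand\<close>). It fixes \<open>as\<close> and \<open>cs\<close> and moves \<open>f as\<close>, contradicting the
  invariance of the graph of \<open>f\<close> (\<open>sat_isomorphism\<close>).

  Hence every value outside the arguments and the parameters lies in a finite part, and the
  required \<open>bs\<close> enumerate the parameters and the union of the finite parts.\<close>

lemma is_isomorphism_bij: "is_isomorphism L M N h \<Longrightarrow> bij_betw h (univ M) (univ N)"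
  by (simp add: is_isomorphism_def)

lemma trm_val_in_univ:
  assumes "is_structure L M" "wf_trm L t" "\<forall>i\<in>trm_vars t. e i \<in> univ M"
  shows "trm_val M e t \<in> univ M"
  using assms(2,3)
proof (induction t)
  case (Fn F ts)
  have "map (trm_val M e) ts \<in> tuples (univ M) (fun_arity L F)"
    using Fn by (auto simp: tuples_def list_all_iff)
  with Fn.prems(1) assms(1) show ?case
    by (simp add: is_structure_def)
qed simp

lemma trm_val_isomorphism:
  assumes "is_structure L M" "is_isomorphism L M N h" "wf_trm L t"
    and "\<forall>i\<in>trm_vars t. e i \<in> univ M \<and> e' i = h (e i)"
  shows "trm_val N e' t = h (trm_val M e t)"
  using assms(3,4)
proof (induction t)
  case (Fn F ts)
  have "map (trm_val M e) ts \<in> tuples (univ M) (fun_arity L F)"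
    using Fn.prems by (auto simp: tuples_def list_all_iff intro!: trm_val_in_univ[OF assms(1)])
  moreover have "map (trm_val N e') ts = map h (map (trm_val M e) ts)"
    using Fn by (auto simp: list_all_iff)
  ultimately show ?case
    using Fn.prems(1) assms(2) by (simp add: is_isomorphism_def del: map_map map_eq_conv)
qed simp

text \<open>The two assignments are only related on the free variables: an assignment read off from a
  list takes unspecified values beyond its length, which neither need lie in the universe nor
  be respected by \<open>h\<close>.\<close>

lemma sat_isomorphism:
  assumes "is_structure L M" "is_isomorphism L M N h" "wf_fm L \<phi>"
    and "\<forall>i\<in>free_vars \<phi>. e i \<in> univ M \<and> e' i = h (e i)"
  shows "sat N e' \<phi> \<longleftrightarrow> sat M e \<phi>"
  using assms(3,4)
proof (induction \<phi> arbitrary: e e')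
  case (Eq s t)
  have "trm_val N e' s = h (trm_val M e s)" "trm_val N e' t = h (trm_val M e t)"
    using Eq by (auto intro!: trm_val_isomorphism[OF assms(1,2)])
  moreover have "trm_val M e s \<in> univ M" "trm_val M e t \<in> univ M"
    using Eq by (auto intro!: trm_val_in_univ[OF assms(1)])
  ultimately show ?case
    using is_isomorphism_bij[OF assms(2)] by (auto simp: bij_betw_def inj_on_eq_iff)
next
  case (Rel R ts)
  have "map (trm_val N e') ts = map h (map (trm_val M e) ts)"
    using Rel by (auto intro!: trm_val_isomorphism[OF assms(1,2)])
  moreover have "map (trm_val M e) ts \<in> tuples (univ M) (rel_arity L R)"
    using Rel by (auto simp: tuples_def intro!: trm_val_in_univ[OF assms(1)])
  ultimately show ?case
    using Rel.prems(1) assms(2) by (simp add: is_isomorphism_def del: map_map map_eq_conv)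
next
  case (And \<phi> \<psi>)
  have "sat N e' \<phi> \<longleftrightarrow> sat M e \<phi>" "sat N e' \<psi> \<longleftrightarrow> sat M e \<psi>"
    using And.prems by (auto intro!: And.IH)
  then show ?case
    by simp
next
  case (Ex i \<phi>)
  have "sat N (e'(i := h x)) \<phi> \<longleftrightarrow> sat M (e(i := x)) \<phi>" if "x \<in> univ M" for x
    using Ex.prems that by (intro Ex.IH) auto
  moreover have "univ N = h ` univ M"
    using is_isomorphism_bij[OF assms(2)] by (simp add: bij_betw_def)
  ultimately show ?case
    by auto
qed auto

text \<open>The list \<open>cs\<close> consists of the parameters of a defining formula; it is chosen once for all
  automorphisms, which is what bounds the set of exceptional values of a definable function.\<close>

lemma definable_set_automorphism:
  assumes "is_structure L M" "definable_set L M k S"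
  obtains cs where "set cs \<subseteq> univ M"
    "\<And>h as. \<lbrakk>is_isomorphism L M M h; \<forall>c\<in>set cs. h c = c; as \<in> S\<rbrakk> \<Longrightarrow> map h as \<in> S"
proof -
  obtain \<phi> cs where wf: "wf_fm L \<phi>" and cs: "set cs \<subseteq> univ M"
    and fv: "free_vars \<phi> \<subseteq> {..<k + length cs}"
    and S: "S = {as \<in> tuples (univ M) k. sat M (\<lambda>i. (as @ cs) ! i) \<phi>}"
    using assms(2) unfolding definable_set_def by blast
  have "map h as \<in> S"
    if h: "is_isomorphism L M M h" and fix_cs: "\<forall>c\<in>set cs. h c = c" and as: "as \<in> S" for h as
  proof -
    have as_tuple: "length as = k" "set as \<subseteq> univ M"
      using as by (auto simp: S tuples_def)
    have map_app: "map h as @ cs = map h (as @ cs)"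
      using fix_cs by (simp add: map_idI)
    have "sat M (\<lambda>i. (map h as @ cs) ! i) \<phi> \<longleftrightarrow> sat M (\<lambda>i. (as @ cs) ! i) \<phi>"
    proof (rule sat_isomorphism[OF assms(1) h wf], rule ballI)
      fix i assume "i \<in> free_vars \<phi>"
      then have i: "i < length (as @ cs)"
        using fv as_tuple(1) by auto
      then have "(as @ cs) ! i \<in> univ M"
        using nth_mem[OF i] as_tuple(2) cs by auto
      with i show "(as @ cs) ! i \<in> univ M \<and> (map h as @ cs) ! i = h ((as @ cs) ! i)"
        unfolding map_app by (simp only: nth_map)
    qed
    moreover have "map h as \<in> tuples (univ M) k"
      using as_tuple is_isomorphism_bij[OF h] by (auto simp: tuples_def bij_betw_def)
    ultimately show ?thesis
      using as by (simp add: S)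
  qed
  with cs show thesis
    using that by blast
qed

lemma is_structure_expand:
  assumes "is_structure L M" "\<And>i. i \<in> {1..n} \<Longrightarrow> X i \<subseteq> univ M"
  shows "is_structure (expand_signature L n) (expand_structure M X)"
  using assms
  by (simp add: is_structure_def expand_signature_def expand_structure_def tuples_def
      subset_iff ball_Un) fastforce

lemma is_isomorphism_expand:
  assumes "is_isomorphism L M N h"
    and "\<And>i x. \<lbrakk>i \<in> {1..n}; x \<in> univ M\<rbrakk> \<Longrightarrow> h x \<in> Y i \<longleftrightarrow> x \<in> X i"
  shows "is_isomorphism (expand_signature L n) (expand_structure M X) (expand_structure N Y) h"
  using assms
  by (auto simp: is_isomorphism_def expand_signature_def expand_structure_def tuples_def
      length_Suc_conv)

lemma transpose_in_Sym_product:
  assumes "disjoint_family_on X {1..n}" "i \<in> {1..n}" "x \<in> X i" "y \<in> X i"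
  shows "transpose x y \<in> Sym_product n X"
proof -
  define \<sigma> where "\<sigma> j = (if j = i then transpose x y else id)" for j
  have "\<sigma> j permutes X j" for j
    using assms(3,4) by (simp add: \<sigma>_def permutes_swap_id permutes_id)
  moreover have "transpose x y z = \<sigma> j z" if "j \<in> {1..n}" "z \<in> X j" for j z
  proof (cases "j = i")
    case False
    then have "X i \<inter> X j = {}"
      using disjoint_family_onD[OF assms(1,2) that(1)] by auto
    with that(2) assms(3,4) have "z \<noteq> x" "z \<noteq> y"
      by auto
    with False show ?thesis
      by (simp add: \<sigma>_def)
  qed (simp add: \<sigma>_def)
  moreover have "transpose x y z = z" if "z \<notin> (\<Union>j\<in>{1..n}. X j)" for z
    using that assms(2-4) by (auto simp: transpose_def)
  ultimately show ?thesis
    unfolding Sym_product_def by blast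
qed

theorem corollary4p14:
  fixes L :: "('f, 'r) signature"
    and M :: "('a, 'f, 'r) structr"
    and X :: "nat \<Rightarrow> 'a set"
    and n r :: nat
    and f :: "'a list \<Rightarrow> 'a"
  assumes "finite_signature L"
    and "relational_signature L"
    and "is_structure L M"
    and "countable (univ M)"
    and "absolutely_ubiquitous L M"
    and "witnesses_finitely_partitioned L M n X"
    and "definable_function (expand_signature L n) (expand_structure M X) r f"
  shows "\<exists>bs. set bs \<subseteq> univ M \<and>
           (\<forall>as\<in>tuples (univ M) r.
              (\<exists>i<r. f as = as ! i) \<or> (\<exists>j<length bs. f as = bs ! j))"
proof -
  let ?L' = "expand_signature L n" and ?M' = "expand_structure M X"
  let ?graph = "{as @ [f as] | as. as \<in> tuples (univ M) r}"
  have cover: "(\<Union>i\<in>{1..n}. X i) = univ M"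
    and aut: "Sym_product n X \<subseteq> carrier (Aut L M)"
    using assms(6)
    by (auto simp: witnesses_finitely_partitioned_def partition_on_def dest: subgroup.subset)
  have disj: "disjoint_family_on X {1..n}"
    using assms(6) unfolding witnesses_finitely_partitioned_def partition_on_def
    by (blast intro: disjoint_image_disjoint_family_on)
  have univ': "univ ?M' = univ M"
    by (simp add: expand_structure_def)
  have f_univ: "\<And>as. as \<in> tuples (univ M) r \<Longrightarrow> f as \<in> univ M"
    and graph: "definable_set ?L' ?M' (Suc r) ?graph"
    using assms(7) by (auto simp: definable_function_def univ')
  have "is_structure ?L' ?M'"
    using assms(3) cover by (intro is_structure_expand) auto
  then obtain cs where cs: "set cs \<subseteq> univ M"
    and invariant: "\<And>h as. \<lbrakk>is_isomorphism ?L' ?M' ?M' h; \<forall>c\<in>set cs. h c = c; as \<in> ?graph\<rbrakk>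
                      \<Longrightarrow> map h as \<in> ?graph"
    using definable_set_automorphism[OF _ graph] unfolding univ' by blast
  define Fin where "Fin = (\<Union>i\<in>{i\<in>{1..n}. finite (X i)}. X i)"
  have "finite Fin"
    by (auto simp: Fin_def)
  then obtain ds where ds: "set ds = Fin"
    using finite_list by blast
  have key: "f as \<in> set as \<union> set cs \<union> Fin" if as: "as \<in> tuples (univ M) r" for as
  proof (rule ccontr)
    assume new: "f as \<notin> set as \<union> set cs \<union> Fin"
    obtain i where i: "i \<in> {1..n}" "f as \<in> X i"
      using f_univ[OF as] unfolding cover[symmetric] by blast
    then have "infinite (X i)"
      using new by (auto simp: Fin_def)
    then have "infinite (X i - insert (f as) (set as \<union> set cs))"
      by (intro Diff_infinite_finite) auto
    then obtain y where y: "y \<in> X i" "y \<noteq> f as" "y \<notin> set as" "y \<notin> set cs"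
      using infinite_imp_nonempty by blast
    let ?h = "transpose (f as) y"
    have "is_isomorphism L M M ?h"
      using transpose_in_Sym_product[OF disj i y(1)] aut by (auto simp: Aut_def)
    moreover have "?h x \<in> X j \<longleftrightarrow> x \<in> X j" if "j \<in> {1..n}" for j x
    proof (cases "j = i")
      case True
      with i(2) y(1) show ?thesis
        by (auto simp: transpose_def)
    next
      case False
      then have "X i \<inter> X j = {}"
        using disjoint_family_onD[OF disj i(1) that] by auto
      with i(2) y(1) show ?thesis
        by (auto simp: transpose_def)
    qed
    ultimately have "is_isomorphism ?L' ?M' ?M' ?h"
      by (intro is_isomorphism_expand)
    moreover have "\<forall>c\<in>set cs. ?h c = c"
      using new y by (auto simp: transpose_def)
    ultimately have "map ?h (as @ [f as]) \<in> ?graph"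
      using as by (intro invariant) auto
    moreover have "map ?h as = as"
      using new y by (intro map_idI) (auto simp: transpose_def)
    ultimately have "y = f as"
      by auto
    with y(2) show False ..
  qed
  have "set (cs @ ds) \<subseteq> univ M"
    using cs ds cover by (auto simp: Fin_def)
  moreover have "(\<exists>i<r. f as = as ! i) \<or> (\<exists>j<length (cs @ ds). f as = (cs @ ds) ! j)"
    if as: "as \<in> tuples (univ M) r" for as
  proof -
    have "f as \<in> set as \<or> f as \<in> set (cs @ ds)"
      using key[OF as] ds by auto
    then show ?thesis
      using as by (auto simp only: in_set_conv_nth tuples_def mem_Collect_eq)
  qed
  ultimately show ?thesis
    by blast
qed

end
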